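(* Let $A$ be a finite set of $n:=|A|\ge 6$ integers with $\min(A)=0$ and $\gcd(A)=1$, and let $l:=\max(A)$. Let $\mathcal{E}$ be the exceptional set of $A$ and $\mathcal{E}'$ the exceptional set of $l-A=\{l-a\colon a\in A\}$. Let $m$ be an integer with $$ m\ge\max\Big\{\,l-\tfrac32\,n+\tfrac92,\ \tfrac23\,(l-n+2)\Big\}. $$ If neither $\{0,1\}\subseteq A\subseteq\{0,1\}\cup[m+2,l]$ nor $\{l-1,l\}\subseteq A\subseteq[0,l-(m+2)]\cup\{l-1,l\}$ holds, then $$ mA=[0,ml]\setminus\big(\mathcal{E}\cup(ml-\mathcal{E}')\big). $$ If either $\{0,1\}\subseteq A\subseteq\{0,1\}\cup[m+2,l]$ or $\{l-1,l\}\subseteq A\subseteq[0,l-(m+2)]\cup\{l-1,l\}$, then this equality does not hold.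
   Context: For a finite set $A$ of integers and a positive integer $m$, $mA:=\{a_1+\dots+a_m\colon a_1,\dots,a_m\in A\}$ is the $m$-fold sumset (summands not necessarily distinct). For integers $x\le y$, $[x,y]$ denotes the set of integers $z$ with $x\le z\le y$ (empty if $x>y$). For a set $B$ of integers and an integer $c$, $c-B:=\{c-b\colon b\in B\}$. The exceptional set of a finite set $B$ of nonnegative integers with $\min(B)=0$ and $\gcd(B)=1$ is the set of all positive integers that cannot be written as a nonnegative integer linear combination of elements of $B$. *)

theory Defs
  imports Complex_Main
begin

definition mfold_sumset :: "nat \<Rightarrow> int set \<Rightarrow> int set" where
  "mfold_sumset m A = {\<Sum>i<m. a i | a. \<forall>i<m. a i \<in> A}"

text \<open>Only meant for finite sets \<open>B\<close> of nonnegative integers with \<open>Min B = 0\<close> and \<open>Gcd B = 1\<close>.\<close>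

definition exceptional_set :: "int set \<Rightarrow> int set" where
  "exceptional_set B = {x. x > 0 \<and> \<not> (\<exists>c :: int \<Rightarrow> nat. x = (\<Sum>b\<in>B. int (c b) * b))}"

end

theory Submission
  imports Defs "HOL-Library.Multiset"
begin

text \<open>
  Suppose that \<open>u\<close> is in the semigroup generated by \<open>A\<close>, \<open>ml - u\<close> in that generated by \<open>l - A\<close>,
  but \<open>u\<close> is not in \<open>mA\<close>. After enlarging \<open>m\<close> one may assume that \<open>u\<close> and \<open>u + l\<close> both lie in
  \<open>(m+1)A\<close>. Optimal representations of these two numbers, with the summands \<open>0\<close> and \<open>l\<close> stripped
  off, are multisets \<open>E\<close> and \<open>G\<close> whose subsums of two or more summands are modulo \<open>l\<close> nonzero and
  outside \<open>A\<close>, that is, holes. Whenever a subsum of \<open>E\<close> agrees modulo \<open>l\<close> with one of \<open>G\<close>, the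
  corresponding parts can be exchanged; a shortest way to walk from \<open>0\<close> along \<open>E\<close> and then along
  \<open>G\<close> to the class of \<open>u\<close> visits at least \<open>m + 2\<close> distinct classes.

  If \<open>E\<close> and \<open>G\<close> both have at least three elements, then \<open>u\<close> is not a sum of two elements of \<open>A\<close>
  modulo \<open>l\<close>, so \<open>u - A\<close> consists of holes as well. It meets the walk in at most three
  classes, and there are more holes than the \<open>l - n + 1\<close> available. Otherwise, up to the reflection
  \<open>a \<mapsto> l - a\<close>, \<open>u < l\<close> is the sum of the \<open>m + 1\<close> elements of \<open>E\<close>; counting holes in pairs
  \<open>{c, u - c}\<close> gives \<open>u \<le> 2m - 1\<close>, which forces \<open>E\<close> to consist of ones only.
\<close>

section \<open>Sumsets and exceptional sets in terms of multisets\<close>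

lemma mfold_sumset_eq_mset:
  "mfold_sumset m A = {sum_mset X |X. set_mset X \<subseteq> A \<and> size X = m}"
proof (intro set_eqI iffI)
  fix w assume "w \<in> mfold_sumset m A"
  then obtain a where a: "\<forall>i<m. a i \<in> A" "w = (\<Sum>i<m. a i)"
    unfolding mfold_sumset_def by blast
  define X where "X = image_mset a (mset_set {..<m})"
  have "set_mset X \<subseteq> A" "size X = m" "w = sum_mset X"
    using a by (auto simp: X_def sum_unfold_sum_mset)
  then show "w \<in> {sum_mset X |X. set_mset X \<subseteq> A \<and> size X = m}" by blast
next
  fix w assume "w \<in> {sum_mset X |X. set_mset X \<subseteq> A \<and> size X = m}"
  then obtain X where X: "set_mset X \<subseteq> A" "size X = m" "w = sum_mset X" by blast
  obtain xs where xs: "mset xs = X" using ex_mset by blast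
  have "w = (\<Sum>i<m. xs ! i)"
    using X xs by (metis sum_mset_sum_list sum_list_sum_nth size_mset atLeast0LessThan)
  moreover have "\<forall>i<m. xs ! i \<in> A"
    using X xs by (metis nth_mem set_mset_mset size_mset subsetD)
  ultimately show "w \<in> mfold_sumset m A"
    unfolding mfold_sumset_def by blast
qed

lemma mfold_sumsetI: "set_mset X \<subseteq> A \<Longrightarrow> size X = m \<Longrightarrow> sum_mset X = u \<Longrightarrow> u \<in> mfold_sumset m A"
  unfolding mfold_sumset_eq_mset by blast

lemma mfold_sumsetE:
  assumes "u \<in> mfold_sumset m A"
  obtains X where "set_mset X \<subseteq> A" "size X = m" "sum_mset X = u"
  using assms unfolding mfold_sumset_eq_mset by blast

lemma mfold_sumset_add:
  assumes "u \<in> mfold_sumset m A" "a \<in> A"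
  shows "u + int k * a \<in> mfold_sumset (m + k) A"
proof -
  obtain X where "set_mset X \<subseteq> A" "size X = m" "sum_mset X = u"
    using assms(1) by (rule mfold_sumsetE)
  then show ?thesis
    using assms(2) by (intro mfold_sumsetI[of "X + replicate_mset k a"]) (auto split: if_splits)
qed

lemma sum_mset_eq_sum_count:
  fixes X :: "int multiset"
  assumes "finite A" "set_mset X \<subseteq> A"
  shows "sum_mset X = (\<Sum>b\<in>A. int (count X b) * b)"
  using assms(2)
proof (induction X)
  case (add x X)
  have "(\<Sum>b\<in>A. int (count (add_mset x X) b) * b)
      = (\<Sum>b\<in>A. int (count X b) * b + (if b = x then b else 0))"
    by (rule sum.cong) (auto simp: algebra_simps)
  also have "\<dots> = sum_mset X + x"
    using add assms(1) by (simp add: sum.distrib)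
  finally show ?case by simp
qed simp

lemma combination_imp_mset:
  fixes c :: "int \<Rightarrow> nat"
  assumes "finite A"
  shows "\<exists>X. set_mset X \<subseteq> A \<and> sum_mset X = (\<Sum>b\<in>A. int (c b) * b)"
  using assms
proof (induction A)
  case (insert a A)
  then obtain X where "set_mset X \<subseteq> A" "sum_mset X = (\<Sum>b\<in>A. int (c b) * b)" by blast
  then show ?case
    using insert by (intro exI[of _ "replicate_mset (c a) a + X"]) (auto split: if_splits)
qed simp

lemma exceptional_set_iff:
  assumes "finite A"
  shows "x \<in> exceptional_set A \<longleftrightarrow> x > 0 \<and> \<not> (\<exists>X. set_mset X \<subseteq> A \<and> sum_mset X = x)"
proof -
  have "(\<exists>c :: int \<Rightarrow> nat. x = (\<Sum>b\<in>A. int (c b) * b)) \<longleftrightarrow> (\<exists>X. set_mset X \<subseteq> A \<and> sum_mset X = x)"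
    (is "?l \<longleftrightarrow> ?r")
  proof
    assume ?l
    then show ?r using combination_imp_mset[OF assms] by metis
  next
    assume ?r
    then show ?l using sum_mset_eq_sum_count[OF assms] by metis
  qed
  then show ?thesis unfolding exceptional_set_def by blast
qed

section \<open>Discrete steps and chains of sub-multisets\<close>

lemma ex_nat_step:
  fixes P :: "nat \<Rightarrow> bool"
  assumes "P n" "\<not> P 0"
  shows "\<exists>i. \<not> P i \<and> P (Suc i)"
  using assms by (induction n) auto

text \<open>Concatenated enumerations of \<open>X\<close>, \<open>Y - X\<close> and
  \<open>Z - Y\<close> give a walk that adds one summand at a time and passes through
  \<open>X\<close> and \<open>Y\<close>; the \<open>C q\<close> are its prefixes.\<close>

lemma mset_chain:
  assumes "X \<subseteq># Y" "Y \<subseteq># Z"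
  obtains C where "\<And>p q. p \<le> q \<Longrightarrow> C p \<subseteq># C q" "\<And>q. q \<le> size Z \<Longrightarrow> size (C q) = q"
    "C (size X) = X" "C (size Y) = Y" "C (size Z) = Z"
proof -
  obtain xs ys zs where l: "mset xs = X" "mset ys = Y - X" "mset zs = Z - Y"
    using ex_mset by metis
  define C where "C q = mset (take q (xs @ ys @ zs))" for q
  have Y: "mset (xs @ ys) = Y" and Z: "mset (xs @ ys @ zs) = Z"
    using l assms by (simp_all add: union_assoc[symmetric])
  have lX: "length xs = size X" and lY: "length xs + length ys = size Y"
    and lZ: "length xs + length ys + length zs = size Z"
    using l(1) arg_cong[OF Y, of size] arg_cong[OF Z, of size] by auto
  show ?thesis
  proof (rule that[of C])
    fix p q :: nat assume "p \<le> q"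
    then have "take p (xs @ ys @ zs) = take p (take q (xs @ ys @ zs))"
      by (simp only: take_take min_absorb1)
    then show "C p \<subseteq># C q" unfolding C_def
      by (metis append_take_drop_id mset_append mset_subset_eq_add_left)
  next
    fix q assume "q \<le> size Z"
    then show "size (C q) = q" using lZ by (simp add: C_def)
  next
    show "C (size X) = X" using l(1) lX by (simp add: C_def)
    show "C (size Y) = Y" using Y lY[symmetric] by (simp add: C_def)
    show "C (size Z) = Z" using Z lZ[symmetric] by (simp add: C_def)
  qed
qed

section \<open>Lattice points, tight multisets and reflection\<close>

text \<open>
  A multiset \<open>X\<close> over \<open>A\<close> stands for the lattice point with coordinates \<open>sum_mset X\<close> and
  \<open>cosum l X\<close>, the latter being the sum of the reflected elements \<open>l - a\<close>.
\<close>

definition cosum :: "int \<Rightarrow> int multiset \<Rightarrow> int" where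
  "cosum l X = int (size X) * l - sum_mset X"

text \<open>
  Tightness is inherited by sub-multisets, and by itself it makes the subsums of two or more
  summands avoid \<open>A\<close> modulo \<open>l\<close>: a subsum \<open>c + d l\<close> with \<open>c \<in> A\<close> could be replaced by \<open>c\<close>
  together with copies of \<open>0\<close> and \<open>l\<close>.
\<close>

definition tight :: "int set \<Rightarrow> int \<Rightarrow> int multiset \<Rightarrow> bool" where
  "tight A l X \<longleftrightarrow> set_mset X \<subseteq> A \<and>
    (\<forall>Y. set_mset Y \<subseteq> A \<and> size Y = size X \<and> sum_mset Y = sum_mset X \<longrightarrow> 0 \<notin># Y \<and> l \<notin># Y)"

definition holes :: "int set \<Rightarrow> int \<Rightarrow> int set" where
  "holes A l = {0<..<l} - A"

lemma cosum_union [simp]: "cosum l (X + Y) = cosum l X + cosum l Y"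
  by (simp add: cosum_def algebra_simps)

lemma finite_holes [simp]: "finite (holes A l)"
  by (simp add: holes_def)

lemma sum_mset_reflect: "sum_mset (image_mset (\<lambda>a. l - a) X) = cosum l X"
  by (induction X) (auto simp: cosum_def algebra_simps)

lemma cosum_reflect: "cosum l (image_mset (\<lambda>a. l - a) X) = sum_mset X"
  by (simp add: cosum_def[of l "image_mset _ _"] sum_mset_reflect) (simp add: cosum_def)

lemma reflect_mset_ex:
  fixes l :: int
  shows "(\<exists>X. set_mset X \<subseteq> (\<lambda>a. l - a) ` A \<and> P X) \<longleftrightarrow>
    (\<exists>Y. set_mset Y \<subseteq> A \<and> P (image_mset (\<lambda>a. l - a) Y))" (is "?l \<longleftrightarrow> ?r")
proof
  assume ?l
  then obtain X where X: "set_mset X \<subseteq> (\<lambda>a. l - a) ` A" "P X" by blast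
  have "set_mset (image_mset (\<lambda>a. l - a) X) \<subseteq> A" using X(1) by auto
  moreover have "image_mset (\<lambda>a. l - a) (image_mset (\<lambda>a. l - a) X) = X"
    by (simp add: image_mset.compositionality comp_def)
  ultimately show ?r using X(2) by metis
next
  assume ?r
  then obtain Y where "set_mset Y \<subseteq> A" "P (image_mset (\<lambda>a. l - a) Y)" by blast
  then show ?l by (intro exI[of _ "image_mset (\<lambda>a. l - a) Y"]) auto
qed

lemma tight_reflect:
  assumes "tight A l X"
  shows "tight ((\<lambda>a. l - a) ` A) l (image_mset (\<lambda>a. l - a) X)"
  unfolding tight_def
proof (intro conjI allI impI)
  show "set_mset (image_mset (\<lambda>a. l - a) X) \<subseteq> (\<lambda>a. l - a) ` A"
    using assms by (auto simp: tight_def)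
  fix Y
  assume Y: "set_mset Y \<subseteq> (\<lambda>a. l - a) ` A \<and> size Y = size (image_mset (\<lambda>a. l - a) X) \<and>
    sum_mset Y = sum_mset (image_mset (\<lambda>a. l - a) X)"
  let ?Z = "image_mset (\<lambda>a. l - a) Y"
  have "set_mset ?Z \<subseteq> A" using Y by auto
  moreover have "size ?Z = size X" "sum_mset ?Z = sum_mset X"
    using Y by (auto simp: sum_mset_reflect cosum_def)
  ultimately have "0 \<notin># ?Z" "l \<notin># ?Z" using assms unfolding tight_def by blast+
  then show "0 \<notin># Y" "l \<notin># Y" by (force simp: image_iff)+
qed

lemma card_holes_reflect: "card (holes ((\<lambda>a. l - a) ` A) l) = card (holes A l)"
proof -
  have "holes ((\<lambda>a. l - a) ` A) l = (\<lambda>a. l - a) ` holes A l"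
  proof (intro set_eqI iffI)
    fix x assume "x \<in> holes ((\<lambda>a. l - a) ` A) l"
    then have "l - x \<in> holes A l" by (force simp: holes_def image_iff)
    then show "x \<in> (\<lambda>a. l - a) ` holes A l" by (force simp: image_iff)
  qed (auto simp: holes_def)
  then show ?thesis by (simp add: card_image inj_on_def)
qed

section \<open>Subsums of tight multisets modulo \<open>l\<close>\<close>

locale sumset_ends =
  fixes A :: "int set" and l :: int
  assumes A_sub: "A \<subseteq> {0..l}" and zero_in: "0 \<in> A" and l_in: "l \<in> A" and l_pos: "l > 0"
begin

lemma sum_mset_nonneg: "set_mset X \<subseteq> A \<Longrightarrow> sum_mset X \<ge> 0"
  using A_sub by (induction X) auto

lemma cosum_nonneg: "set_mset X \<subseteq> A \<Longrightarrow> cosum l X \<ge> 0"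
  using A_sub by (induction X) (auto simp: cosum_def algebra_simps)

lemma sum_cosum_mono:
  assumes "X \<subseteq># Y" "set_mset Y \<subseteq> A"
  shows "sum_mset X \<le> sum_mset Y" "cosum l X \<le> cosum l Y"
proof -
  obtain Z where Z: "Y = X + Z" using assms(1) by (metis subset_mset.le_iff_add)
  then show "sum_mset X \<le> sum_mset Y" "cosum l X \<le> cosum l Y"
    using assms(2) sum_mset_nonneg[of Z] cosum_nonneg[of Z] by auto
qed

lemma tightD: "tight A l X \<Longrightarrow> set_mset X \<subseteq> A"
  by (simp add: tight_def)

lemma tight_no_ends:
  "tight A l X \<Longrightarrow> set_mset Y \<subseteq> A \<Longrightarrow> size Y = size X \<Longrightarrow> sum_mset Y = sum_mset X \<Longrightarrow> 0 \<notin># Y \<and> l \<notin># Y"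
  by (simp add: tight_def)

lemma tight_elem: "tight A l X \<Longrightarrow> a \<in># X \<Longrightarrow> 0 < a \<and> a < l"
proof -
  assume "tight A l X" "a \<in># X"
  then have "a \<in> {0..l}" "a \<noteq> 0" "a \<noteq> l"
    using tight_no_ends[of X X] tightD[of X] A_sub by auto
  then show ?thesis by auto
qed

lemma tight_subset:
  assumes "tight A l X" "Y \<subseteq># X"
  shows "tight A l Y"
  unfolding tight_def
proof (intro conjI allI impI)
  show "set_mset Y \<subseteq> A" using assms tightD set_mset_mono by blast
  fix W assume W: "set_mset W \<subseteq> A \<and> size W = size Y \<and> sum_mset W = sum_mset Y"
  obtain Z where Z: "X = Y + Z" using assms(2) by (metis subset_mset.le_iff_add)
  have "0 \<notin># W + Z \<and> l \<notin># W + Z"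
    using W Z tightD[OF assms(1)] by (intro tight_no_ends[OF assms(1)]) auto
  then show "0 \<notin># W" "l \<notin># W" by auto
qed

lemma tight_sum_bounds:
  "tight A l X \<Longrightarrow> int (size X) \<le> sum_mset X \<and> sum_mset X \<le> int (size X) * (l - 1)"
proof (induction X)
  case (add a X)
  have "tight A l X" using add.prems by (rule tight_subset) simp
  moreover have "0 < a \<and> a < l" using add.prems tight_elem by force
  ultimately show ?case using add.IH by (simp add: algebra_simps)
qed simp

lemma tight_sum_notin:
  assumes "tight A l X" "size X \<ge> 2"
  shows "sum_mset X mod l \<notin> A"
proof
  assume c: "sum_mset X mod l \<in> A"
  define c d where "c = sum_mset X mod l" and "d = sum_mset X div l"
  have s: "sum_mset X = d * l + c" by (simp add: c_def d_def)
  note b = tight_sum_bounds[OF assms(1)]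
  have "d \<ge> 0" using b l_pos by (simp add: d_def pos_imp_zdiv_nonneg_iff)
  have "c \<ge> 0" using l_pos by (simp add: c_def)
  \<comment> \<open>The upper bound on the sum of a tight multiset gives \<open>d < size X\<close>,
    so \<open>c\<close> and \<open>d\<close> copies of \<open>l\<close> can be filled up with copies
    of \<open>0\<close> to exactly \<open>size X\<close> summands.\<close>
  have "d * l < int (size X) * l"
    using b s \<open>c \<ge> 0\<close> assms(2) by (simp add: algebra_simps)
  then have "d < int (size X)" using l_pos by simp
  then obtain p q where pq: "int p = d" "size X = Suc (p + q)"
    using \<open>d \<ge> 0\<close> by (metis nat_int nat_eq_iff of_nat_less_iff less_iff_Suc_add zero_le_imp_eq_int)
  define Y where "Y = add_mset c (replicate_mset p l + replicate_mset q 0)"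
  have "0 \<notin># Y \<and> l \<notin># Y"
    using c[folded c_def] zero_in l_in pq s
    by (intro tight_no_ends[OF assms(1)]) (auto simp: Y_def split: if_splits)
  then show False using assms(2) pq by (auto simp: Y_def split: if_splits)
qed

lemma tight_sum_nonzero:
  assumes "tight A l X" "X \<noteq> {#}"
  shows "sum_mset X mod l \<noteq> 0"
proof (cases "size X \<ge> 2")
  case True
  then show ?thesis using tight_sum_notin[OF assms(1)] zero_in by metis
next
  case False
  then have "size X = 1" using assms(2) by (metis One_nat_def Suc_1 less_2_cases not_le size_eq_0_iff_empty)
  then obtain a where "X = {#a#}" using size_1_singleton_mset by blast
  then show ?thesis using tight_elem[OF assms(1), of a] by auto
qed

text \<open>Otherwise the difference of \<open>Y\<close> and \<open>X\<close> would be a nonempty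
  tight multiset with sum \<open>0\<close> modulo \<open>l\<close>.\<close>

lemma tight_subsum_eq:
  assumes "tight A l Z" "Y \<subseteq># Z" "X \<subseteq># Y" "sum_mset X mod l = sum_mset Y mod l"
  shows "X = Y"
proof (rule ccontr)
  assume "X \<noteq> Y"
  obtain W where W: "Y = X + W" using assms(3) by (metis subset_mset.le_iff_add)
  have "tight A l W" using tight_subset[OF assms(1)] W assms(2)
    by (meson mset_subset_eq_add_right subset_mset.order_trans)
  moreover have "W \<noteq> {#}" using W \<open>X \<noteq> Y\<close> by auto
  moreover have "sum_mset W mod l = 0" using assms(4) W
    by (metis add_diff_cancel_left' mod_0 mod_diff_cong cancel_comm_monoid_add_class.diff_cancel sum_mset.union)
  ultimately show False using tight_sum_nonzero[of W] by simp
qed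

section \<open>Reduction to a corner\<close>

text \<open>Among the representations of the same size and sum, take one with the most copies of
  \<open>p\<close> and strip these off. A competitor of the rest \<open>F\<close> cannot contain
  \<open>p\<close> by maximality, nor \<open>q\<close> by \<open>no_q\<close>. The cases
  \<open>p = l\<close> and \<open>p = 0\<close> will produce \<open>E\<close> and
  \<open>G\<close>.\<close>

lemma tight_core:
  assumes X: "set_mset X \<subseteq> A"
    and pq: "{p, q} = {0, l}"
    and no_q: "\<And>Y. set_mset Y \<subseteq> A \<Longrightarrow> size Y = size X \<Longrightarrow> sum_mset Y = sum_mset X \<Longrightarrow> q \<notin># Y"
  obtains F i where "tight A l F" "size F + i = size X" "sum_mset F + int i * p = sum_mset X"
proof -
  let ?P = "\<lambda>Y. set_mset Y \<subseteq> A \<and> size Y = size X \<and> sum_mset Y = sum_mset X"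
  have "\<forall>Y. ?P Y \<longrightarrow> count Y p < Suc (size X)" by (metis count_le_size less_Suc_eq_le)
  then obtain Y where Y: "?P Y" and maxi: "\<And>Z. ?P Z \<Longrightarrow> count Z p \<le> count Y p"
    using ex_has_greatest_nat[of ?P X "\<lambda>Y. count Y p" "Suc (size X)"] X by blast
  define F where "F = filter_mset (\<lambda>a. a \<noteq> p) Y"
  have YF: "Y = F + replicate_mset (count Y p) p"
    unfolding F_def by (rule multiset_eqI) auto
  have pA: "p \<in> A" using pq zero_in l_in by (metis doubleton_eq_iff)
  have "tight A l F"
    unfolding tight_def
  proof (intro conjI allI impI)
    show "set_mset F \<subseteq> A" using Y by (auto simp: F_def)
    fix W assume W: "set_mset W \<subseteq> A \<and> size W = size F \<and> sum_mset W = sum_mset F"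
    let ?V = "W + replicate_mset (count Y p) p"
    have s: "size ?V = size X" "sum_mset ?V = sum_mset X" using W Y YF
      by (metis size_union, metis sum_mset.union)
    then have V: "?P ?V" using W pA by (auto split: if_splits)
    have "q \<notin># W" using no_q[of ?V] V by auto
    moreover have "p \<notin># W" using maxi[OF V] by (auto simp: not_in_iff)
    ultimately show "0 \<notin># W" "l \<notin># W" using pq by (metis doubleton_eq_iff)+
  qed
  moreover have "size F + count Y p = size X" using Y YF by (metis size_union size_replicate_mset)
  moreover have "sum_mset F + int (count Y p) * p = sum_mset X"
    using Y arg_cong[OF YF, of sum_mset] by simp
  ultimately show ?thesis using that by blast
qed

text \<open>In the coordinates (sum, cosum), adding a summand \<open>l\<close> or \<open>0\<close>
  moves a point by \<open>l\<close> in the first or the second direction. Moving first in the one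
  direction and then in the other, one stops each time just before the point becomes
  representable.\<close>

lemma ex_corner:
  assumes X: "set_mset X \<subseteq> A" "sum_mset X = u"
    and Y: "set_mset Y \<subseteq> A" "cosum l Y = int m * l - u"
    and u: "u \<notin> mfold_sumset m A"
  obtains m' u' where "m' \<ge> m" "u' \<notin> mfold_sumset m' A"
    "u' \<in> mfold_sumset (Suc m') A" "u' + l \<in> mfold_sumset (Suc m') A"
proof -
  let ?R = "\<lambda>h. mfold_sumset h A"
  let ?P = "\<lambda>i. u + int i * l \<in> ?R (m + i)"
  have Ys: "sum_mset Y = u + (int (size Y) - int m) * l"
    using Y(2) by (simp add: cosum_def algebra_simps)
  have Yin: "sum_mset Y \<in> ?R (size Y)" using Y(1) by (intro mfold_sumsetI) auto
  have "\<exists>i. ?P i"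
  proof (cases "m \<le> size Y")
    case True
    then show ?thesis using Yin Ys by (intro exI[of _ "size Y - m"]) (simp add: of_nat_diff)
  next
    case False
    \<comment> \<open>This case is void: \<open>Y\<close> filled up with copies of \<open>l\<close>
      would make \<open>u\<close> an \<open>m\<close>-fold sum.\<close>
    then have "sum_mset Y + int (m - size Y) * l = u" using Ys by (simp add: of_nat_diff algebra_simps)
    then show ?thesis using mfold_sumset_add[OF Yin l_in, of "m - size Y"] False u by simp
  qed
  then obtain i where i: "\<not> ?P i" "?P (Suc i)"
    using ex_nat_step[of ?P] u by auto
  define u' m1 where "u' = u + int i * l" and "m1 = m + i"
  have u': "u' \<notin> ?R m1" "u' + l \<in> ?R (Suc m1)"
    using i by (auto simp: u'_def m1_def algebra_simps)
  let ?Q = "\<lambda>j. u' \<in> ?R (m1 + j)"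
  have "u' \<in> ?R (size X + i + m)"
    using mfold_sumset_add[OF mfold_sumset_add[OF mfold_sumsetI[OF X(1) refl X(2)] l_in, of i] zero_in, of m]
    by (simp add: u'_def)
  then have "?Q (size X)" by (simp add: m1_def ac_simps)
  then obtain j where j: "\<not> ?Q j" "?Q (Suc j)"
    using ex_nat_step[of ?Q] u'(1) by auto
  show ?thesis
  proof (rule that[of "m1 + j" u'])
    show "u' + l \<in> ?R (Suc (m1 + j))"
      using mfold_sumset_add[OF u'(2) zero_in, of j] by simp
  qed (use j in \<open>auto simp: m1_def\<close>)
qed

end


section \<open>Hybrids of the two cores at a corner\<close>

text \<open>\<open>E\<close> and \<open>G\<close> come from representations of \<open>u\<close> and
  \<open>u + l\<close> by \<open>m + 1\<close> summands, with \<open>i\<close> copies of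
  \<open>l\<close> and \<open>j\<close> copies of \<open>0\<close> removed. These represent the two
  neighbours of the point \<open>(u, m l - u)\<close>, which itself is not represented.\<close>

locale corner = sumset_ends +
  fixes m :: nat and u :: int and E G :: "int multiset" and i j :: nat
  assumes E: "tight A l E" "size E + i = Suc m" "sum_mset E + int i * l = u"
    and G: "tight A l G" "size G + j = Suc m" "sum_mset G = u + l"
    and u_notin: "u \<notin> mfold_sumset m A"
begin

definition link :: "int multiset \<Rightarrow> int multiset \<Rightarrow> bool" where
  "link X Y \<longleftrightarrow> X \<subseteq># E \<and> Y \<subseteq># G \<and> sum_mset X mod l = sum_mset Y mod l"

text \<open>
  For linked \<open>X\<close> and \<open>Y\<close>, the hybrid \<open>X + (G - Y)\<close> represents the class of \<open>u\<close>; as \<open>u\<close> is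
  not an \<open>m\<close>-fold sum, the hybrid exceeds \<open>(u, m l - u)\<close> in the first coordinate (\<open>low\<close>) or
  in the second (\<open>high\<close>).
\<close>

definition low :: "int multiset \<Rightarrow> int multiset \<Rightarrow> bool" where
  "low X Y \<longleftrightarrow> sum_mset X + sum_mset G - sum_mset Y > u"

definition high :: "int multiset \<Rightarrow> int multiset \<Rightarrow> bool" where
  "high X Y \<longleftrightarrow> cosum l X + cosum l G - cosum l Y > int m * l - u"

lemma set_E: "set_mset E \<subseteq> A" and set_G: "set_mset G \<subseteq> A"
  using E(1) G(1) tightD by blast+

lemma cosum_E: "cosum l E = int m * l - u + l"
proof -
  have "int (size E) = int m + 1 - int i" using E(2) by linarith
  then show ?thesis
    unfolding cosum_def using E(3) by (simp add: left_diff_distrib distrib_right)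
qed

lemma cosum_G: "cosum l G = int m * l - u - int j * l"
proof -
  have "int (size G) = int m + 1 - int j" using G(2) by linarith
  then show ?thesis
    unfolding cosum_def using G(3) by (simp add: left_diff_distrib distrib_right)
qed

lemma sum_E_mod: "sum_mset E mod l = u mod l" and sum_G_mod: "sum_mset G mod l = u mod l"
  using E(3) G(3) by auto

lemma u_nonneg: "u \<ge> 0" and u_le: "u \<le> int m * l"
proof -
  show "u \<ge> 0" using E(3) sum_mset_nonneg[OF set_E] l_pos
    by (metis add_nonneg_nonneg mult_nonneg_nonneg of_nat_0_le_iff order_less_imp_le)
  have "int j * l \<ge> 0" using l_pos by simp
  then show "u \<le> int m * l" using cosum_nonneg[OF set_G] cosum_G by linarith
qed

text \<open>A multiset in the class of \<open>u\<close> that exceeds neither coordinate could be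
  filled up with copies of \<open>l\<close> and \<open>0\<close> to an \<open>m\<close>-fold
  representation of \<open>u\<close>.\<close>

lemma exceeds:
  assumes "set_mset X \<subseteq> A" "sum_mset X mod l = u mod l"
  shows "sum_mset X > u \<or> cosum l X > int m * l - u"
proof (rule ccontr)
  assume "\<not> ?thesis"
  then have le: "sum_mset X \<le> u" "cosum l X \<le> int m * l - u" by auto
  obtain d where d: "u - sum_mset X = l * d" using assms(2) by (metis mod_eq_dvd_iff dvdE)
  have "0 \<le> l * d" using d le(1) by linarith
  then have "d \<ge> 0" using l_pos by (simp add: zero_le_mult_iff)
  then obtain k where k: "d = int k" by (metis zero_le_imp_eq_int)
  have "(int (size X) + int k) * l \<le> int m * l"
    using le(2) d k by (simp add: cosum_def algebra_simps)
  then have "size X + k \<le> m" using l_pos by simp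
  moreover have "u \<in> mfold_sumset (size X + k + (m - (size X + k))) A"
    using mfold_sumset_add[OF mfold_sumset_add[OF mfold_sumsetI[OF assms(1) refl refl] l_in, of k] zero_in, of "m - (size X + k)"] d k
    by (simp add: algebra_simps)
  ultimately show False using u_notin by simp
qed

lemma link_mod:
  assumes "link X Y"
  shows "(sum_mset X + sum_mset G - sum_mset Y) mod l = u mod l"
proof -
  obtain d where "sum_mset X - sum_mset Y = l * d"
    using assms by (metis link_def mod_eq_dvd_iff dvdE)
  then have "sum_mset X + sum_mset G - sum_mset Y = sum_mset G + l * d" by simp
  then have "(sum_mset X + sum_mset G - sum_mset Y) mod l = sum_mset G mod l"
    by (simp only: mod_mult_self2)
  then show ?thesis by (simp only: sum_G_mod)
qed

text \<open>The excess is a positive multiple of \<open>l\<close>, since the hybrid lies in the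
  class of \<open>u\<close>.\<close>

lemma low_ge:
  assumes "link X Y" "low X Y"
  shows "sum_mset X + sum_mset G - sum_mset Y \<ge> u + l"
proof -
  have "l dvd (sum_mset X + sum_mset G - sum_mset Y) - u"
    using link_mod[OF assms(1)] by (metis mod_eq_dvd_iff)
  then show ?thesis using assms(2) zdvd_imp_le[of l "sum_mset X + sum_mset G - sum_mset Y - u"]
    by (simp add: low_def)
qed

lemma high_ge:
  assumes "link X Y" "high X Y"
  shows "cosum l X + cosum l G - cosum l Y \<ge> int m * l - u + l"
proof -
  let ?s = "sum_mset X + sum_mset G - sum_mset Y" and ?k = "int (size X) + int (size G) - int (size Y)"
  have "cosum l X + cosum l G - cosum l Y - (int m * l - u) = (u - ?s) + (?k - int m) * l"
    by (simp add: cosum_def algebra_simps)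
  moreover have "l dvd u - ?s" using link_mod[OF assms(1)] by (metis mod_eq_dvd_iff)
  ultimately have "l dvd cosum l X + cosum l G - cosum l Y - (int m * l - u)"
    by (metis dvd_add dvd_triv_right)
  then show ?thesis
    using assms(2) zdvd_imp_le[of l "cosum l X + cosum l G - cosum l Y - (int m * l - u)"]
    by (simp add: high_def)
qed

text \<open>One of the two holds by \<open>exceeds\<close>. If both held, the complementary hybrid
  \<open>(E - X) + Y\<close> would exceed neither coordinate, because the two hybrids together use
  up \<open>E\<close> and \<open>G\<close>.\<close>

lemma low_iff_not_high:
  assumes "link X Y"
  shows "low X Y \<longleftrightarrow> \<not> high X Y"
proof -
  obtain X' Y' where X': "E = X + X'" and Y': "G = Y + Y'"
    using assms by (metis link_def subset_mset.le_iff_add)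
  have "low X Y \<or> high X Y"
  proof -
    have "sum_mset (X + Y') mod l = u mod l"
      using link_mod[OF assms] Y' by simp
    moreover have "set_mset (X + Y') \<subseteq> A" using set_E set_G X' Y' by auto
    ultimately have "sum_mset (X + Y') > u \<or> cosum l (X + Y') > int m * l - u" using exceeds by blast
    moreover have "sum_mset G = sum_mset Y + sum_mset Y'" "cosum l G = cosum l Y + cosum l Y'"
      using Y' by simp_all
    ultimately show ?thesis by (simp add: low_def high_def)
  qed
  moreover have False if "low X Y" "high X Y"
  proof -
    have le: "sum_mset X' + sum_mset Y \<le> u - int i * l" "cosum l X' + cosum l Y \<le> int m * l - u - int j * l"
      using low_ge[OF assms that(1)] high_ge[OF assms that(2)] E(3) G(3) cosum_E cosum_G
        arg_cong[OF X', of sum_mset] arg_cong[OF X', of "cosum l"] by auto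
    have "int i * l \<ge> 0" "int j * l \<ge> 0" using l_pos by auto
    moreover have "(sum_mset X' + sum_mset Y) mod l = (sum_mset X' + sum_mset X) mod l"
      using assms by (metis link_def mod_add_right_eq)
    then have "sum_mset (X' + Y) mod l = u mod l" using X' sum_E_mod by (simp add: add.commute)
    ultimately show False using exceeds[of "X' + Y"] set_E set_G X' Y' le by auto
  qed
  ultimately show ?thesis by blast
qed

lemma link_sub_eq:
  assumes "link X Y" "link X Y'" "Y \<subseteq># Y'"
  shows "Y = Y'"
  using assms G(1) tight_subsum_eq by (metis link_def)

section \<open>Configurations and shortest walks\<close>

text \<open>
  A configuration encodes the walk along \<open>E\<close> through \<open>E1\<close> to \<open>E2\<close>, joined to the walk along \<open>G\<close>
  from \<open>G1\<close> through \<open>G2\<close> to \<open>G\<close>; the two pass through common classes at \<open>E1, G1\<close> and at \<open>E2, G2\<close>.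
  In a configuration minimising the number \<open>size E2 + size G - size G1\<close> of steps, any further
  crossing would yield a shorter one.
\<close>

definition config :: "int multiset \<Rightarrow> int multiset \<Rightarrow> int multiset \<Rightarrow> int multiset \<Rightarrow> bool" where
  "config E1 E2 G1 G2 \<longleftrightarrow> E1 \<subseteq># E2 \<and> G1 \<subseteq># G2 \<and> link E1 G1 \<and> link E2 G2 \<and> low E1 G1 \<and> high E2 G2"

lemma config_trivial: "config {#} E {#} G"
  using sum_E_mod sum_G_mod G(3) cosum_E l_pos
  by (simp add: config_def link_def low_def high_def cosum_def)

text \<open>The number of steps times \<open>l\<close> splits into the first coordinate of the low
  hybrid, at least \<open>u + l\<close>, the second coordinate of the high one, at least
  \<open>m l - u + l\<close>, and two nonnegative differences. The one from \<open>E1\<close> to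
  \<open>E2\<close> is positive, as \<open>E1 = E2\<close> would force
  \<open>G1 = G2\<close>.\<close>

lemma config_size:
  assumes "config E1 E2 G1 G2"
  shows "m + 3 \<le> size E2 + size G - size G1"
proof -
  note c = assms[unfolded config_def]
  have sub: "E2 \<subseteq># E" "G2 \<subseteq># G" using c by (auto simp: link_def)
  have "E1 \<noteq> E2"
  proof
    assume "E1 = E2"
    then have "G1 = G2" using c link_sub_eq by blast
    then show False using c \<open>E1 = E2\<close> low_iff_not_high by blast
  qed
  obtain Z where Z: "E2 = E1 + Z" using c by (metis subset_mset.le_iff_add)
  have "tight A l Z" using E(1) sub(1) Z by (metis tight_subset mset_subset_eq_add_right)
  then have pos: "sum_mset E1 < sum_mset E2"
    using tight_sum_bounds[of Z] Z \<open>E1 \<noteq> E2\<close> by (cases "Z = {#}") (auto simp: nonempty_has_size)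
  have "set_mset G2 \<subseteq> A" using sub(2) set_G set_mset_mono by blast
  then have le: "cosum l G1 \<le> cosum l G2" using c sum_cosum_mono by blast
  have sz: "size G1 \<le> size G" using c by (simp add: link_def size_mset_mono)
  have "(int (size E2) + int (size G) - int (size G1)) * l
      = (sum_mset E1 + sum_mset G - sum_mset G1) + (cosum l E2 + cosum l G - cosum l G2)
        + (sum_mset E2 - sum_mset E1) + (cosum l G2 - cosum l G1)"
    by (simp add: cosum_def algebra_simps)
  also have "\<dots> > (int m + 2) * l"
    using low_ge[of E1 G1] high_ge[of E2 G2] c pos le by (simp add: algebra_simps)
  finally have "int (size E2) + int (size G) - int (size G1) > int m + 2" using l_pos by simp
  then show ?thesis using sz by linarith
qed

text \<open>Suppose \<open>X\<close> differs from \<open>E2\<close>. If the crossing is low, then it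
  replaces \<open>E1, G1\<close> in a shorter configuration, or monotonicity of sums makes
  \<open>E2, G2\<close> low. If it is high, then it replaces \<open>E2, G2\<close>, or monotonicity
  of cosums makes \<open>E1, G1\<close> high.\<close>

lemma config_crossing:
  assumes c: "config E1 E2 G1 G2"
    and mini: "\<And>E1' E2' G1' G2'. config E1' E2' G1' G2' \<Longrightarrow>
      size E2 + size G - size G1 \<le> size E2' + size G - size G1'"
    and X: "X \<subseteq># E1 \<or> E1 \<subseteq># X" "X \<subseteq># E2"
    and Y: "G1 \<subset># Y" "Y \<subseteq># G" "Y \<subseteq># G2 \<or> G2 \<subseteq># Y"
    and XY: "sum_mset X mod l = sum_mset Y mod l"
  shows "X = E2"
proof (rule ccontr)
  assume "X \<noteq> E2"
  note c' = c[unfolded config_def]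
  have sub: "E2 \<subseteq># E" "G2 \<subseteq># G" using c' by (auto simp: link_def)
  have lXY: "link X Y" using X(2) Y(2) XY sub subset_mset.order_trans unfolding link_def by blast
  have sG: "size G1 < size Y" "size Y \<le> size G" using Y by (auto simp: mset_subset_size size_mset_mono)
  have sX: "size X < size E2" using X(2) \<open>X \<noteq> E2\<close> by (simp add: mset_subset_size subset_mset.less_le)
  have sets: "set_mset E1 \<subseteq> A" "set_mset E2 \<subseteq> A" "set_mset Y \<subseteq> A"
    using c' set_mset_mono[of E1 E2] set_mset_mono[OF sub(1)] set_mset_mono[OF Y(2)] set_E set_G
    by auto
  show False
  proof (cases "low X Y")
    case True
    have "\<not> Y \<subseteq># G2"
    proof
      assume "Y \<subseteq># G2"
      then have "config X E2 Y G2" using c' True lXY X(2) by (simp add: config_def)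
      then show False using mini[of X E2 Y G2] sG by linarith
    qed
    then have "sum_mset X + sum_mset G - sum_mset Y \<le> sum_mset E2 + sum_mset G - sum_mset G2"
      using Y(3) sum_cosum_mono(1)[OF X(2) sets(2)] sum_cosum_mono(1)[of G2 Y] sets by auto
    then show False using True c' low_iff_not_high[of E2 G2] by (simp add: low_def)
  next
    case False
    then have hi: "high X Y" using low_iff_not_high[OF lXY] by blast
    have "\<not> E1 \<subseteq># X"
    proof
      assume "E1 \<subseteq># X"
      then have "config E1 X G1 Y" using c' hi lXY Y(1) by (simp add: config_def subset_mset.less_imp_le)
      then show False using mini[of E1 X G1 Y] sG sX by linarith
    qed
    then have "cosum l X + cosum l G - cosum l Y \<le> cosum l E1 + cosum l G - cosum l G1"
      using X(1) sum_cosum_mono(2)[of X E1] sum_cosum_mono(2)[of G1 Y] sets Y(1)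
      by (auto simp: subset_mset.less_imp_le)
    then show False using hi c' low_iff_not_high[of E1 G1] by (simp add: high_def)
  qed
qed

lemma ex_min_config:
  obtains E1 E2 G1 G2 where "config E1 E2 G1 G2"
    "\<And>E1' E2' G1' G2'. config E1' E2' G1' G2' \<Longrightarrow>
      size E2 + size G - size G1 \<le> size E2' + size G - size G1'"
proof -
  let ?P = "\<lambda>(E1, E2, G1, G2). config E1 E2 G1 G2"
  let ?f = "\<lambda>(E1 :: int multiset, E2, G1, G2 :: int multiset). size E2 + size G - size G1"
  have "?P ({#}, E, {#}, G)" using config_trivial by simp
  from ex_has_least_nat[of ?P, OF this, of ?f] obtain t
    where t: "?P t" "\<forall>y. ?P y \<longrightarrow> ?f t \<le> ?f y" by blast
  obtain E1 E2 G1 G2 where "t = (E1, E2, G1, G2)" by (cases t)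
  then show ?thesis using t by (intro that[of E1 E2 G1 G2]) auto
qed

section \<open>Counting holes when both cores have at least three elements\<close>

lemma chain_inj:
  assumes "tight A l Z" "\<And>p q. p \<le> q \<Longrightarrow> C p \<subseteq># C q" "\<And>q. q \<le> size Z \<Longrightarrow> size (C q) = q"
    "C (size Z) = Z"
  shows "inj_on (\<lambda>q. sum_mset (C q) mod l) {..size Z}"
proof -
  have *: "p = q" if "p \<le> q" "q \<le> size Z" "sum_mset (C p) mod l = sum_mset (C q) mod l" for p q
  proof -
    have "C q \<subseteq># Z" using assms(2)[OF that(2)] assms(4) by simp
    then have "C p = C q" using tight_subsum_eq[OF assms(1)] assms(2)[OF that(1)] that(3) by blast
    then show ?thesis using assms(3) that(1,2) by (metis order_trans)
  qed
  show ?thesis by (rule inj_onI) (metis * atMost_iff nle_le)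
qed

text \<open>If \<open>c + d\<close> were in the class of \<open>u\<close> with
  \<open>d \<in> A\<close>, then by \<open>exceeds\<close> and the size of \<open>c + d\<close> it
  would either equal the sum of \<open>G\<close>, or equal that of \<open>E\<close> after adding
  \<open>size E - 2\<close> copies of \<open>l\<close>. Padding with \<open>0\<close> or
  \<open>l\<close> then contradicts tightness; three elements ensure that some padding
  occurs.\<close>

lemma complement_mod_notin:
  assumes "size E \<ge> 3" "size G \<ge> 3" "c \<in> A" "c < l"
  shows "(u - c) mod l \<notin> A"
proof
  define d where "d = (u - c) mod l"
  assume "(u - c) mod l \<in> A"
  then have dA: "d \<in> A" by (simp add: d_def)
  have d: "0 \<le> d" "d < l" using l_pos by (auto simp: d_def)
  have c: "0 \<le> c" using assms(3) A_sub by auto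
  have "(c + d) mod l = u mod l" unfolding d_def by (simp add: mod_add_right_eq)
  then obtain r where r: "c + d - u = l * r" by (metis mod_eq_dvd_iff dvdE)
  have "c + d > u \<or> cosum l {#c, d#} > int m * l - u"
    using exceeds[of "{#c, d#}"] assms(3) dA \<open>(c + d) mod l = u mod l\<close> by simp
  then consider "r > 0" | "r < 2 - int m"
  proof
    assume "c + d > u"
    then have "l * r > 0" using r by linarith
    then show ?thesis using that(1) l_pos by (simp add: zero_less_mult_iff)
  next
    assume "cosum l {#c, d#} > int m * l - u"
    then have "l * r < l * (2 - int m)" using r by (simp add: cosum_def algebra_simps)
    then show ?thesis using that(2) l_pos by (simp add: mult_less_cancel_left)
  qed
  then show False
  proof cases
    case 1
    have "l * r < l * 2" using r u_nonneg d assms(4) by linarith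
    then have "r = 1" using 1 l_pos by simp
    let ?Y = "{#c, d#} + replicate_mset (size G - 2) 0"
    have "0 \<notin># ?Y \<and> l \<notin># ?Y"
      using assms dA zero_in G(3) r \<open>r = 1\<close>
      by (intro tight_no_ends[OF G(1)]) (auto split: if_splits)
    then show False using assms(2) by (auto split: if_splits)
  next
    case 2
    \<comment> \<open>This excludes \<open>r = - m\<close>.\<close>
    have "c + d \<noteq> 0"
    proof
      assume "c + d = 0"
      then have "u mod l = 0" using \<open>(c + d) mod l = u mod l\<close> by simp
      moreover have "E \<noteq> {#}" using assms(1) by force
      ultimately show False using tight_sum_nonzero[OF E(1)] sum_E_mod by simp
    qed
    then have "l * r > l * (- int m)" using r c d u_le by (simp add: algebra_simps)
    then have "r > - int m" using l_pos mult_less_cancel_left_pos by blast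
    then have "r = 1 - int m" using 2 by simp
    moreover have "int (size E - 2) = int m - 1 - int i" using E(2) assms(1) by linarith
    ultimately have "r + int (size E - 2) = - int i" by simp
    then have "l * (r + int (size E - 2)) = - (int i * l)" by simp
    then have sum: "c + d + int (size E - 2) * l = sum_mset E"
      using r E(3) by (simp add: algebra_simps)
    let ?Y = "{#c, d#} + replicate_mset (size E - 2) l"
    have "0 \<notin># ?Y \<and> l \<notin># ?Y"
      using assms dA l_in sum
      by (intro tight_no_ends[OF E(1)]) (auto split: if_splits)
    then show False using assms(1) by (auto split: if_splits)
  qed
qed

text \<open>The shortest walk visits a set \<open>N\<close> of at least \<open>m + 2\<close>
  classes, at most two of them in \<open>A\<close>. The set \<open>R\<close> of classes
  \<open>u - a\<close> consists of \<open>card A - 1\<close> holes, at most three of them in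
  \<open>N\<close>. Hence there are at least \<open>(m + 2) - 2 + (card A - 1) - 3\<close>
  holes.\<close>

lemma size_le_holes:
  assumes "finite A" "size E \<ge> 3" "size G \<ge> 3"
  shows "m + card A \<le> card (holes A l) + 4"
proof -
  obtain E1 E2 G1 G2 where c: "config E1 E2 G1 G2"
    and mini: "\<And>E1' E2' G1' G2'. config E1' E2' G1' G2' \<Longrightarrow>
      size E2 + size G - size G1 \<le> size E2' + size G - size G1'"
    by (rule ex_min_config) blast
  have sub: "E1 \<subseteq># E2" "E2 \<subseteq># E" "G1 \<subseteq># G2" "G2 \<subseteq># G" using c by (auto simp: config_def link_def)
  obtain C where C: "\<And>p q. p \<le> q \<Longrightarrow> C p \<subseteq># C q" "\<And>q. q \<le> size E \<Longrightarrow> size (C q) = q"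
    "C (size E1) = E1" "C (size E2) = E2" "C (size E) = E"
    by (rule mset_chain[OF sub(1,2)]) blast
  obtain D where D: "\<And>p q. p \<le> q \<Longrightarrow> D p \<subseteq># D q" "\<And>q. q \<le> size G \<Longrightarrow> size (D q) = q"
    "D (size G1) = G1" "D (size G2) = G2" "D (size G) = G"
    by (rule mset_chain[OF sub(3,4)]) blast
  define f g where "f q = sum_mset (C q) mod l" and "g q = sum_mset (D q) mod l" for q
  have injf: "inj_on f {..size E}" unfolding f_def by (rule chain_inj[OF E(1) C(1,2,5)])
  have injg: "inj_on g {..size G}" unfolding g_def by (rule chain_inj[OF G(1) D(1,2,5)])
  have sz: "size E2 \<le> size E" "size G1 \<le> size G"
    using sub size_mset_mono by (blast, meson order_trans)
  define N1 N2 where "N1 = f ` {1..size E2}" and "N2 = g ` {size G1<..size G}"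
  have fin: "finite N1" "finite N2" by (simp_all add: N1_def N2_def)
  have c1: "card N1 = size E2" unfolding N1_def
    using inj_on_subset[OF injf, of "{1..size E2}"] sz by (subst card_image) auto
  have c2: "card N2 = size G - size G1" unfolding N2_def
    using inj_on_subset[OF injg, of "{size G1<..size G}"] by (subst card_image) (auto simp: subset_iff)
  \<comment> \<open>By minimality the two parts of the walk meet only where they are joined.\<close>
  have "N1 \<inter> N2 \<subseteq> {sum_mset E2 mod l}"
  proof
    fix w assume "w \<in> N1 \<inter> N2"
    then obtain p q where pq: "p \<le> size E2" "w = f p" "size G1 < q" "q \<le> size G" "w = g q"
      by (auto simp: N1_def N2_def)
    have "C p = E2"
    proof (rule config_crossing[OF c mini])
      show "C p \<subseteq># E1 \<or> E1 \<subseteq># C p" using C(1)[of p "size E1"] C(1)[of "size E1" p] C(3) by (metis nle_le)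
      show "C p \<subseteq># E2" using C(1)[OF pq(1)] C(4) by simp
      show "G1 \<subset># D q" using D(1)[of "size G1" q] D(3) D(2)[OF pq(4)] pq(3)
        by (metis less_imp_le nat_neq_iff subset_mset.less_le)
      show "D q \<subseteq># G" using D(1)[OF pq(4)] D(5) by simp
      show "D q \<subseteq># G2 \<or> G2 \<subseteq># D q" using D(1)[of q "size G2"] D(1)[of "size G2" q] D(4) by (metis nle_le)
      show "sum_mset (C p) mod l = sum_mset (D q) mod l" using pq by (simp add: f_def g_def)
    qed
    then show "w \<in> {sum_mset E2 mod l}" using pq by (simp add: f_def)
  qed
  then have "card (N1 \<inter> N2) \<le> 1" using card_mono[of "{sum_mset E2 mod l}" "N1 \<inter> N2"] by simp
  define N where "N = N1 \<union> N2"
  have cN: "m + 2 \<le> card N"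
    using card_Un_Int[OF fin] c1 c2 \<open>card (N1 \<inter> N2) \<le> 1\<close> config_size[OF c] sz unfolding N_def by linarith
  have finN: "finite N" using fin by (simp add: N_def)
  have tC: "tight A l (C q)" "tight A l (E - C q)" if "q \<le> size E" for q
    using C(1)[OF that] C(5) by (auto intro: tight_subset[OF E(1)])
  have tD: "tight A l (D q)" "tight A l (G - D q)" if "q \<le> size G" for q
    using D(1)[OF that] D(5) by (auto intro: tight_subset[OF G(1)])
  have sum_diff: "sum_mset (Z - Y) mod l = (u - sum_mset Y mod l) mod l"
    if "Y \<subseteq># Z" "sum_mset Z mod l = u mod l" for Y Z
  proof -
    have "sum_mset (Z - Y) = sum_mset Z - sum_mset Y"
      using that(1) by (metis add_diff_cancel_left' subset_mset.add_diff_inverse sum_mset.union)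
    then show ?thesis using that(2) by (metis mod_diff_eq mod_mod_trivial)
  qed
  have NE: "w \<in> N \<Longrightarrow> (\<exists>q. 1 \<le> q \<and> q \<le> size E \<and> w = f q) \<or> (\<exists>q. 1 \<le> q \<and> q \<le> size G \<and> w = g q)" for w
    using sz by (force simp: N_def N1_def N2_def)
  have N_pos: "N \<subseteq> {0<..<l}"
  proof
    fix w assume "w \<in> N"
    from NE[OF this] have "w \<noteq> 0"
    proof (elim disjE exE conjE)
      fix q assume "1 \<le> q" "q \<le> size E" "w = f q"
      then show "w \<noteq> 0" using tight_sum_nonzero[OF tC(1)[of q]] C(2)[of q] by (force simp: f_def)
    next
      fix q assume "1 \<le> q" "q \<le> size G" "w = g q"
      then show "w \<noteq> 0" using tight_sum_nonzero[OF tD(1)[of q]] D(2)[of q] by (force simp: g_def)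
    qed
    moreover have "0 \<le> w" "w < l" using NE[OF \<open>w \<in> N\<close>] l_pos by (auto simp: f_def g_def)
    ultimately show "w \<in> {0<..<l}" by simp
  qed
  have NA: "N \<inter> A \<subseteq> {f 1, g 1}"
  proof
    fix w assume w: "w \<in> N \<inter> A"
    then have "w \<in> N" by simp
    from NE[OF this] show "w \<in> {f 1, g 1}"
    proof (elim disjE exE conjE)
      fix q assume q: "1 \<le> q" "q \<le> size E" "w = f q"
      then have "q < 2" using tight_sum_notin[OF tC(1)[of q]] C(2)[of q] w by (force simp: f_def)
      then have "q = 1" using q by simp
      then show ?thesis using q by simp
    next
      fix q assume q: "1 \<le> q" "q \<le> size G" "w = g q"
      then have "q < 2" using tight_sum_notin[OF tD(1)[of q]] D(2)[of q] w by (force simp: g_def)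
      then have "q = 1" using q by simp
      then show ?thesis using q by simp
    qed
  qed
  define R where "R = (\<lambda>c. (u - c) mod l) ` (A - {l})"
  have Al: "A - {l} \<subseteq> {0..<l}" using A_sub by auto
  have "inj_on (\<lambda>c. (u - c) mod l) (A - {l})"
  proof (rule inj_onI)
    fix a b assume ab: "a \<in> A - {l}" "b \<in> A - {l}" "(u - a) mod l = (u - b) mod l"
    then have "l dvd b - a" by (metis mod_eq_dvd_iff diff_diff_eq2 diff_add_cancel add_diff_cancel_left')
    moreover have "a \<in> {0..<l}" "b \<in> {0..<l}" using ab Al by blast+
    then have "\<bar>b - a\<bar> < l" by auto
    ultimately show "a = b" using dvd_imp_le_int[of "b - a" l] l_pos by auto
  qed
  then have cR: "card R = card A - 1" unfolding R_def using assms(1) l_in by (simp add: card_image)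
  have RE: thesis if R: "w \<in> R"
    and hyp: "\<And>a. a \<in> A \<Longrightarrow> a < l \<Longrightarrow> w = (u - a) mod l \<Longrightarrow> 0 \<le> a \<Longrightarrow> thesis" for w thesis
  proof -
    obtain a where a: "a \<in> A - {l}" "w = (u - a) mod l" using R unfolding R_def by blast
    then have "a \<in> {0..<l}" using Al by blast
    then show thesis using hyp[of a] a by simp
  qed
  have RH: "R \<subseteq> holes A l"
  proof
    fix w assume "w \<in> R"
    then obtain a where a: "a \<in> A" "a < l" "w = (u - a) mod l" by (rule RE)
    then have "w \<notin> A" using complement_mod_notin assms by blast
    moreover have "0 \<le> w" "w < l" using a l_pos by auto
    moreover have "w \<noteq> 0" using \<open>w \<notin> A\<close> zero_in by blast
    ultimately show "w \<in> holes A l" by (simp add: holes_def)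
  qed
  \<comment> \<open>If a partial sum of either walk is in the class of \<open>u - a\<close>, the
    summands still to come add up to \<open>a \<in> A\<close> modulo \<open>l\<close>, so tightness
    leaves at most one of them.\<close>
  have NR: "N \<inter> R \<subseteq> {u mod l, f (size E - 1), g (size G - 1)}"
  proof
    fix w assume w: "w \<in> N \<inter> R"
    then have "w \<in> R" by simp
    then obtain a where a: "a \<in> A" "a < l" "w = (u - a) mod l" "0 \<le> a" by (rule RE)
    have "(u - w) mod l = a" using a by (simp add: mod_diff_right_eq)
    have "w \<in> N" using w by simp
    from NE[OF this] show "w \<in> {u mod l, f (size E - 1), g (size G - 1)}"
    proof (elim disjE exE conjE)
      fix q assume q: "1 \<le> q" "q \<le> size E" "w = f q"
      have s: "C q \<subseteq># E" using C(1)[OF q(2)] C(5) by simp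
      have "sum_mset (E - C q) mod l = a"
        using sum_diff[OF s sum_E_mod] q(3) \<open>(u - w) mod l = a\<close> by (simp add: f_def)
      then have "size (E - C q) < 2" using tight_sum_notin[OF tC(2)[OF q(2)]] a(1) by force
      then have "q = size E \<or> q = size E - 1" using C(2)[OF q(2)] size_Diff_submset[OF s] q by linarith
      then show ?thesis using q(3) C(5) sum_E_mod by (auto simp: f_def)
    next
      fix q assume q: "1 \<le> q" "q \<le> size G" "w = g q"
      have s: "D q \<subseteq># G" using D(1)[OF q(2)] D(5) by simp
      have "sum_mset (G - D q) mod l = a"
        using sum_diff[OF s sum_G_mod] q(3) \<open>(u - w) mod l = a\<close> by (simp add: g_def)
      then have "size (G - D q) < 2" using tight_sum_notin[OF tD(2)[OF q(2)]] a(1) by force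
      then have "q = size G \<or> q = size G - 1" using D(2)[OF q(2)] size_Diff_submset[OF s] q by linarith
      then show ?thesis using q(3) D(5) sum_G_mod by (auto simp: g_def)
    qed
  qed
  have cNA: "card (N \<inter> A) \<le> 2"
    using card_mono[OF _ NA] card_insert_le_m1[of 2 "{g 1}" "f 1"] by simp
  have cNR: "card (N \<inter> R) \<le> 3"
  proof -
    have "card {u mod l, f (size E - 1), g (size G - 1)} \<le> 3" by (simp add: card_insert_if)
    then show ?thesis using card_mono[OF _ NR] by simp
  qed
  have finR: "finite R" using assms(1) by (simp add: R_def)
  have "(N - A) \<union> R \<subseteq> holes A l" using RH N_pos by (auto simp: holes_def)
  then have "card ((N - A) \<union> R) \<le> card (holes A l)" by (intro card_mono) auto
  moreover have "card ((N - A) \<union> R) + card ((N - A) \<inter> R) = card (N - A) + card R"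
    using card_Un_Int[of "N - A" R] finN finR by simp
  moreover have "card ((N - A) \<inter> R) \<le> card (N \<inter> R)" by (rule card_mono) (use finN in auto)
  moreover have "card (N - A) + card (N \<inter> A) = card N"
    using card_Diff_subset_Int[of N A] finN card_mono[of N "N \<inter> A"] by simp
  moreover have "card A \<ge> 1" using assms(1) zero_in by (metis One_nat_def Suc_leI card_gt_0_iff empty_iff)
  ultimately show ?thesis using cN cR cNA cNR by linarith
qed

end

section \<open>Tight multisets with sum below \<open>l\<close>\<close>

context sumset_ends
begin

text \<open>Pairing \<open>c\<close> with \<open>u - c\<close> shows that holes outnumber elements
  of \<open>A\<close> below \<open>u\<close>, the more so because partial sums give pairs of two
  holes. As holes are few, \<open>u\<close> is below \<open>2 * s\<close>, and this leaves room for
  ones only.\<close>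

lemma tight_small_sum:
  assumes t: "tight A l X" and lt: "sum_mset X < l" and s3: "size X \<ge> 3"
    and few: "2 * card (holes A l) + 5 \<le> 3 * size X"
  shows "{0, 1} \<subseteq> A" "A \<subseteq> {0, 1} \<union> {int (size X) + 1..l}"
proof -
  define u s where "u = sum_mset X" and "s = size X"
  note b = tight_sum_bounds[OF t, folded u_def s_def]
  have sub_notin: "sum_mset Y \<notin> A" if "Y \<subseteq># X" "size Y \<ge> 2" for Y
  proof -
    have "0 \<le> sum_mset Y" "sum_mset Y < l"
      using sum_mset_nonneg tightD[OF tight_subset[OF t that(1)]]
        sum_cosum_mono(1)[OF that(1) tightD[OF t]] lt by auto
    then show ?thesis using tight_sum_notin[OF tight_subset[OF t that(1)] that(2)] by simp
  qed
  obtain C where C: "\<And>p q. p \<le> q \<Longrightarrow> C p \<subseteq># C q" "\<And>q. q \<le> size X \<Longrightarrow> size (C q) = q" "C (size X) = X"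
    by (rule mset_chain[of "{#}" X X]) auto
  have Cs: "C q \<subseteq># X" "size (C q) = q" if "q \<le> s" for q
    using C(1)[of q "size X"] C(2,3) that by (auto simp: s_def)
  have Cu: "sum_mset (X - C q) = u - sum_mset (C q)" "size (X - C q) = s - q" if "q \<le> s" for q
    using Cs[OF that] sum_mset.union[of "C q" "X - C q"] size_Diff_submset[of "C q" X]
    by (auto simp: u_def s_def)
  define W where "W = (\<lambda>q. sum_mset (C q)) ` {2..s - 2}"
  have "strict_mono_on {..s} (\<lambda>q. sum_mset (C q))"
  proof (rule strict_mono_onI)
    fix p q assume pq: "p \<in> {..s}" "q \<in> {..s}" "p < q"
    have le: "C p \<subseteq># C q" using C(1) pq by simp
    have "tight A l (C q - C p)" using Cs(1)[of q] pq
      by (meson t tight_subset diff_subset_eq_self subset_mset.order_trans atMost_iff)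
    moreover have "size (C q - C p) = q - p" using size_Diff_submset[OF le] Cs(2) pq by simp
    ultimately have "sum_mset (C q - C p) > 0" using tight_sum_bounds pq(3) by force
    then show "sum_mset (C p) < sum_mset (C q)"
      using sum_mset.union[of "C p" "C q - C p"] le by simp
  qed
  then have "inj_on (\<lambda>q. sum_mset (C q)) {2..s - 2}"
    by (meson strict_mono_on_imp_inj_on inj_on_subset atMost_iff atLeastAtMost_iff subsetI diff_le_self order_trans)
  then have cW: "card W = s - 3" by (simp add: W_def card_image)
  define I where "I = {0<..<u}"
  \<comment> \<open>Padded with at least one \<open>0\<close>, such a pair would compete with the
    tight \<open>X\<close>.\<close>
  have no_pair: "u - c \<notin> A" if "c \<in> A" for c
  proof
    assume "u - c \<in> A"
    let ?Y = "{#c, u - c#} + replicate_mset (s - 2) 0"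
    have "0 \<notin># ?Y \<and> l \<notin># ?Y"
      using that \<open>u - c \<in> A\<close> s3 zero_in
      by (intro tight_no_ends[OF t]) (auto simp: u_def s_def split: if_splits)
    then show False using s3 by (auto simp: s_def split: if_splits)
  qed
  have W: "w \<in> I \<and> w \<notin> A \<and> u - w \<notin> A" if wW: "w \<in> W" for w
  proof -
    obtain q where q: "2 \<le> q" "q \<le> s - 2" "w = sum_mset (C q)" using wW by (auto simp: W_def)
    have qs: "q \<le> s" using q by simp
    have "X - C q \<subseteq># X" by simp
    then have "u - w \<notin> A" using sub_notin[of "X - C q"] Cu[OF qs] q s3 by (simp add: s_def)
    moreover have "w \<notin> A" using sub_notin[of "C q"] Cs[OF qs] q by simp
    moreover have "w > 0" "u - w > 0"
      using tight_sum_bounds[OF tight_subset[OF t Cs(1)[OF qs]]] Cs(2)[OF qs] q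
        tight_sum_bounds[OF tight_subset[OF t \<open>X - C q \<subseteq># X\<close>]] Cu[OF qs] s3 by (auto simp: s_def)
    ultimately show ?thesis by (simp add: I_def)
  qed
  have "(\<lambda>c. u - c) ` (I \<inter> A) \<subseteq> (I - A) - W"
  proof
    fix w assume "w \<in> (\<lambda>c. u - c) ` (I \<inter> A)"
    then obtain c where c: "c \<in> I" "c \<in> A" "w = u - c" by auto
    then have "u - w \<in> A" by simp
    moreover have "w \<in> I - A" using c no_pair by (auto simp: I_def)
    ultimately show "w \<in> (I - A) - W" using W by blast
  qed
  then have "card ((\<lambda>c. u - c) ` (I \<inter> A)) \<le> card ((I - A) - W)"
    by (intro card_mono) (auto simp: I_def)
  moreover have "card ((\<lambda>c. u - c) ` (I \<inter> A)) = card (I \<inter> A)" by (intro card_image) (auto simp: inj_on_def)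
  moreover have WI: "W \<subseteq> I - A" using W by auto
  then have "card ((I - A) - W) + card W = card (I - A)"
    using card_Diff_subset[of W "I - A"] card_mono[of "I - A" W] finite_subset[of W "I - A"]
    by (simp add: I_def)
  ultimately have half: "card (I \<inter> A) + (s - 3) \<le> card (I - A)" using cW by linarith
  have cI: "card (I \<inter> A) + card (I - A) = nat (u - 1)"
    using card_Int_Diff[of I A] by (simp add: I_def)
  have "u \<notin> A" using sub_notin[of X] s3 by (simp add: u_def)
  then have "insert u (I - A) \<subseteq> holes A l" using lt b s3 by (auto simp: I_def holes_def u_def s_def)
  then have "card (insert u (I - A)) \<le> card (holes A l)" by (intro card_mono) auto
  then have "card (I - A) + 1 \<le> card (holes A l)" by (simp add: I_def)
  \<comment> \<open>The pairing gives \<open>u - 1 \<le> 2 * card (I - A) - (s - 3)\<close>, and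
    \<open>u\<close> is a further hole outside \<open>I\<close>; \<open>few\<close> does the
    rest.\<close>
  then have u_le: "u \<le> 2 * int s - 3" using half cI few s3 b unfolding s_def by linarith
  define \<mu> where "\<mu> = count X 1"
  obtain Z where Z: "X = replicate_mset \<mu> 1 + Z" "1 \<notin># Z"
  proof (rule that[of "filter_mset (\<lambda>a. a \<noteq> 1) X"])
    show "X = replicate_mset \<mu> 1 + filter_mset (\<lambda>a. a \<noteq> 1) X" by (rule multiset_eqI) (auto simp: \<mu>_def)
  qed simp
  have uZ: "u = int \<mu> + sum_mset Z" and sZ: "s = \<mu> + size Z" using Z by (auto simp: u_def s_def)
  have lower: "int (size V) * k \<le> sum_mset V" if "\<forall>a\<in>#V. a \<ge> k" for V and k :: int
    using that by (induction V) (auto simp: algebra_simps)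
  have "\<forall>a\<in>#Z. a \<ge> 2"
  proof
    fix a assume "a \<in># Z"
    then have "a > 0" "a \<noteq> 1" using tight_elem[OF t, of a] Z by auto
    then show "a \<ge> 2" by simp
  qed
  \<comment> \<open>Without ones, \<open>u\<close> would be at least \<open>2 * s\<close>.\<close>
  then have "\<mu> \<ge> 1" using lower[of Z 2] uZ sZ u_le by simp
  then have "1 \<in># X" by (simp add: \<mu>_def Suc_le_eq)
  then show one: "{0, 1} \<subseteq> A" using tightD[OF t] zero_in by auto
  have big: "a > int \<mu>" if "a \<in> A" "a \<ge> 2" for a
  proof (rule ccontr)
    assume "\<not> ?thesis"
    then have "replicate_mset (nat a) 1 \<subseteq># replicate_mset \<mu> (1::int)" by (simp add: subseteq_mset_def)
    then have "replicate_mset (nat a) 1 \<subseteq># X" using Z(1) by (simp add: subset_mset.add_increasing2)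
    moreover have "2 \<le> nat a" using that by linarith
    ultimately show False using sub_notin[of "replicate_mset (nat a) 1"] that by simp
  qed
  have "Z = {#}"
  proof (rule ccontr)
    assume "Z \<noteq> {#}"
    then have z1: "size Z \<ge> 1" by (simp add: Suc_le_eq nonempty_has_size)
    have "\<forall>a\<in>#Z. a \<ge> int \<mu> + 1" using big \<open>\<forall>a\<in>#Z. a \<ge> 2\<close> tightD[OF t] Z(1) by force
    then have "int (size Z) * (int \<mu> + 1) \<le> sum_mset Z" using lower by blast
    \<comment> \<open>Expanded, this bounds \<open>\<mu> + size Z * (\<mu> + 1)\<close> from below
      by \<open>2 * s - 1\<close>, more than \<open>u_le\<close> allows.\<close>
    moreover have "(int (size Z) - 1) * (int \<mu> - 1) \<ge> 0" using z1 \<open>\<mu> \<ge> 1\<close> by simp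
    ultimately show False using uZ sZ u_le by (simp add: algebra_simps)
  qed
  then have "s = \<mu>" using sZ by simp
  show "A \<subseteq> {0, 1} \<union> {int (size X) + 1..l}"
  proof
    fix a assume "a \<in> A"
    then have "0 \<le> a" "a \<le> l" using A_sub by auto
    then show "a \<in> {0, 1} \<union> {int (size X) + 1..l}"
      using big[OF \<open>a \<in> A\<close>] \<open>s = \<mu>\<close> by (cases "a \<ge> 2") (auto simp: s_def)
  qed
qed

section \<open>Representability in both coordinates, and the extremal shape of a
  counterexample\<close>

lemma reflect: "sumset_ends ((\<lambda>a. l - a) ` A) l"
  using A_sub zero_in l_in l_pos by unfold_locales (auto simp: image_iff)

lemma representable_iff:
  assumes "finite A" "0 \<le> u" "u \<le> int m * l"
  shows "u \<notin> exceptional_set A \<union> (\<lambda>e. int m * l - e) ` exceptional_set ((\<lambda>a. l - a) ` A) \<longleftrightarrow>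
    (\<exists>X. set_mset X \<subseteq> A \<and> sum_mset X = u) \<and> (\<exists>Y. set_mset Y \<subseteq> A \<and> cosum l Y = int m * l - u)"
proof -
  let ?B = "(\<lambda>a. l - a) ` A"
  \<comment> \<open>Exceptional sets have only positive elements, and \<open>0\<close> is the empty
    sum.\<close>
  have "u \<notin> exceptional_set A \<longleftrightarrow> (\<exists>X. set_mset X \<subseteq> A \<and> sum_mset X = u)"
    using exceptional_set_iff[OF assms(1), of u] assms(2)
    by (metis empty_subsetI order_less_le set_mset_empty sum_mset.empty)
  moreover have "int m * l - u \<notin> exceptional_set ?B \<longleftrightarrow>
      (\<exists>X. set_mset X \<subseteq> ?B \<and> sum_mset X = int m * l - u)"
    using exceptional_set_iff[of ?B "int m * l - u"] assms(1,3)
    by (metis diff_ge_0_iff_ge empty_subsetI finite_imageI order_less_le set_mset_empty sum_mset.empty)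
  moreover have "(\<exists>X. set_mset X \<subseteq> ?B \<and> sum_mset X = v) \<longleftrightarrow> (\<exists>Y. set_mset Y \<subseteq> A \<and> cosum l Y = v)" for v
    using reflect_mset_ex[where A = A and l = l and P = "\<lambda>X. sum_mset X = v"] by (simp add: sum_mset_reflect)
  moreover have "u \<in> (\<lambda>e. int m * l - e) ` exceptional_set ?B \<longleftrightarrow> int m * l - u \<in> exceptional_set ?B"
    by (force simp: image_iff)
  ultimately show ?thesis by blast
qed

text \<open>At a corner, \<open>many\<close> forbids that both cores have three elements. A core of
  at most two elements confines \<open>w\<close> to less than \<open>l\<close> from one end of
  \<open>[0, m' l]\<close>, so the other core has full size \<open>m' + 1\<close> and small sum, up
  to reflection.\<close>

lemma nonrepresented_imp_extremal:
  assumes fin: "finite A"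
    and X: "set_mset X \<subseteq> A" "sum_mset X = u"
    and Y: "set_mset Y \<subseteq> A" "cosum l Y = int m * l - u"
    and u: "u \<notin> mfold_sumset m A"
    and many: "card (holes A l) + 4 < m + card A"
    and few: "2 * card (holes A l) + 2 \<le> 3 * m"
  shows "{0, 1} \<subseteq> A \<and> A \<subseteq> {0, 1} \<union> {int m + 2..l} \<or>
    {l - 1, l} \<subseteq> A \<and> A \<subseteq> {0..l - (int m + 2)} \<union> {l - 1, l}"
proof -
  obtain m' w where w: "m' \<ge> m" "w \<notin> mfold_sumset m' A"
    "w \<in> mfold_sumset (Suc m') A" "w + l \<in> mfold_sumset (Suc m') A"
    by (rule ex_corner[OF X Y u])
  have drop: "sum_mset Z - a \<in> mfold_sumset m' A"
    if Z: "set_mset Z \<subseteq> A" "size Z = Suc m'" "a \<in># Z" for Z a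
  proof -
    obtain V where "Z = add_mset a V" using Z(3) by (metis insert_DiffM)
    then show ?thesis using Z by (intro mfold_sumsetI[of V]) auto
  qed
  obtain E0 where E0: "set_mset E0 \<subseteq> A" "size E0 = Suc m'" "sum_mset E0 = w"
    using w(3) by (rule mfold_sumsetE)
  obtain E i where E: "tight A l E" "size E + i = size E0" "sum_mset E + int i * l = sum_mset E0"
  proof (rule tight_core[OF E0(1), of l 0])
    show "0 \<notin># V" if "set_mset V \<subseteq> A" "size V = size E0" "sum_mset V = sum_mset E0" for V
      using drop[of V 0] that E0 w(2) by auto
  qed auto
  obtain G0 where G0: "set_mset G0 \<subseteq> A" "size G0 = Suc m'" "sum_mset G0 = w + l"
    using w(4) by (rule mfold_sumsetE)
  obtain G j where G: "tight A l G" "size G + j = size G0" "sum_mset G + int j * 0 = sum_mset G0"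
  proof (rule tight_core[OF G0(1), of 0 l])
    show "l \<notin># V" if "set_mset V \<subseteq> A" "size V = size G0" "sum_mset V = sum_mset G0" for V
      using drop[of V l] that G0 w(2) by auto
  qed auto
  interpret corner A l m' w E G i j
    by unfold_locales (use E G E0 G0 w in auto)
  \<comment> \<open>A tight pair yields a hole, whence \<open>few\<close> gives
    \<open>m \<ge> 2\<close>, so that a core of size \<open>m' + 1\<close> has three
    elements.\<close>
  have m2: "m \<ge> 2" if "tight A l Z" "size Z = 2" for Z
  proof -
    have "sum_mset Z mod l \<notin> A" using tight_sum_notin[OF that(1)] that(2) by simp
    moreover have "sum_mset Z mod l \<noteq> 0" using calculation zero_in by metis
    moreover have "0 \<le> sum_mset Z mod l" "sum_mset Z mod l < l" using l_pos by simp_all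
    ultimately have "sum_mset Z mod l \<in> holes A l" by (simp add: holes_def)
    then have "card (holes A l) > 0" by (auto simp: card_gt_0_iff)
    then show ?thesis using few by linarith
  qed
  have "\<not> (size E \<ge> 3 \<and> size G \<ge> 3)" using size_le_holes[OF fin] many w(1) by linarith
  then consider "size G \<le> 2" | "size E \<le> 2" by linarith
  then show ?thesis
  proof cases
    case 1
    have sG: "w + l \<le> int (size G) * (l - 1)" using tight_sum_bounds[OF G(1)] G(3) G0(3) by simp
    have "int (size G) * (l - 1) \<le> 1 * (l - 1)" if "size G \<le> 1"
      using that l_pos by (intro mult_right_mono) auto
    then have "size G = 2" using sG u_nonneg 1 by force
    then have "w < l" using sG by simp
    have "i = 0"
    proof (rule ccontr)
      assume "i \<noteq> 0"
      then have "1 * l \<le> int i * l" using l_pos by (intro mult_right_mono) auto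
      then show False using E(3) E0(3) sum_mset_nonneg[OF set_E] \<open>w < l\<close> by linarith
    qed
    then have "size E = Suc m'" "sum_mset E < l" using E E0 \<open>w < l\<close> by auto
    moreover have "m \<ge> 2" using m2[OF G(1)] \<open>size G = 2\<close> by simp
    ultimately have "{0, 1} \<subseteq> A" "A \<subseteq> {0, 1} \<union> {int (Suc m') + 1..l}"
      using tight_small_sum[OF E(1)] few w(1) by auto
    then show ?thesis using w(1) by fastforce
  next
    case 2
    have sE: "int m' * l - w + l \<le> int (size E) * (l - 1)"
      using tight_sum_bounds[OF E(1)] cosum_E by (simp add: cosum_def algebra_simps)
    have "int (size E) * (l - 1) \<le> 1 * (l - 1)" if "size E \<le> 1"
      using that l_pos by (intro mult_right_mono) auto
    then have "size E = 2" using sE u_le 2 by force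
    then have "int m' * l - w < l" using sE by simp
    have "j = 0"
    proof (rule ccontr)
      assume "j \<noteq> 0"
      then have "1 * l \<le> int j * l" using l_pos by (intro mult_right_mono) auto
      then show False using cosum_G cosum_nonneg[OF set_G] \<open>int m' * l - w < l\<close> by linarith
    qed
    \<comment> \<open>After reflection \<open>G\<close> takes the part that \<open>E\<close> had in
      the first case.\<close>
    let ?B = "(\<lambda>a. l - a) ` A" and ?G = "image_mset (\<lambda>a. l - a) G"
    interpret B: sumset_ends ?B l by (rule reflect)
    have "tight ?B l ?G" by (rule tight_reflect[OF G(1)])
    moreover have "size ?G = Suc m'" "sum_mset ?G < l"
      using G G0 \<open>j = 0\<close> cosum_G \<open>int m' * l - w < l\<close> by (auto simp: sum_mset_reflect)
    moreover have "m \<ge> 2" using m2[OF E(1)] \<open>size E = 2\<close> by simp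
    ultimately have B: "{0, 1} \<subseteq> ?B" "?B \<subseteq> {0, 1} \<union> {int (Suc m') + 1..l}"
      using B.tight_small_sum[of ?G] few w(1) by (auto simp: card_holes_reflect)
    have "l - 1 \<in> A" using B(1) by (auto simp: image_iff) (metis diff_diff_eq2 add_diff_cancel_left')
    then have "{l - 1, l} \<subseteq> A" using l_in by simp
    moreover have "A \<subseteq> {0..l - (int m + 2)} \<union> {l - 1, l}"
    proof
      fix a assume "a \<in> A"
      then have "l - a \<in> {0, 1} \<union> {int (Suc m') + 1..l}" using B(2) by blast
      then show "a \<in> {0..l - (int m + 2)} \<union> {l - 1, l}" using w(1) by auto
    qed
    ultimately show ?thesis by blast
  qed
qed

section \<open>Failure of the equality in the extremal cases\<close>

text \<open>The number \<open>m + 1\<close> is a sum of \<open>m + 1\<close> ones, but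
  \<open>m\<close> summands from \<open>A\<close> not above it are too small. On the reflected side,
  \<open>m + 1\<close> summands suffice: two elements of \<open>A\<close> with sum
  \<open>m + 1 + l\<close>, and zeros.\<close>

lemma extremal_imp_nonrepresented:
  assumes fin: "finite A" and six: "card A \<ge> 6" and m1: "m \<ge> 1"
    and many: "l + 4 < 2 * int (card A) + int m"
    and ex: "{0, 1} \<subseteq> A" "A \<subseteq> {0, 1} \<union> {int m + 2..l}"
  shows "int m + 1 \<notin> mfold_sumset m A"
    and "\<exists>X. set_mset X \<subseteq> A \<and> sum_mset X = int m + 1"
    and "\<exists>Y. set_mset Y \<subseteq> A \<and> cosum l Y = int m * l - (int m + 1)"
proof -
  show "int m + 1 \<notin> mfold_sumset m A"
  proof
    assume "int m + 1 \<in> mfold_sumset m A"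
    then obtain X where X: "set_mset X \<subseteq> A" "size X = m" "sum_mset X = int m + 1"
      by (rule mfold_sumsetE)
    have "a \<le> 1" if "a \<in># X" for a
    proof -
      have "{#a#} \<subseteq># X" using that by simp
      then have "a \<le> int m + 1" using sum_cosum_mono(1)[OF _ X(1)] X(3) by fastforce
      moreover have "a \<in> {0, 1} \<union> {int m + 2..l}" using that X(1) ex(2) by blast
      ultimately show ?thesis by auto
    qed
    then have "sum_mset X \<le> int (size X)" by (induction X) force+
    then show False using X by simp
  qed
  show "\<exists>X. set_mset X \<subseteq> A \<and> sum_mset X = int m + 1"
    using ex(1) by (intro exI[of _ "replicate_mset (Suc m) 1"]) auto
  let ?K = "{int m + 2..l - 1}" and ?r = "\<lambda>c. int m + 1 + l - c"
  \<comment> \<open>Pigeonhole: \<open>?r\<close> is an involution of \<open>?K\<close>, which by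
    \<open>many\<close> is too short to contain both \<open>A \<inter> ?K\<close> and a disjoint
    mirror image.\<close>
  have "\<exists>c \<in> A. ?r c \<in> A"
  proof (rule ccontr)
    assume no: "\<not> ?thesis"
    have finK: "finite (A \<inter> ?K)" by simp
    have "A \<subseteq> {0, 1, l} \<union> (A \<inter> ?K)" using ex(2) by force
    then have "card A \<le> card ({0, 1, l} \<union> (A \<inter> ?K))" by (intro card_mono) auto
    also have "\<dots> \<le> card {0, 1, l} + card (A \<inter> ?K)" by (rule card_Un_le)
    also have "card {0, 1, l} \<le> 3" by (simp add: card_insert_if)
    finally have cA: "card A \<le> 3 + card (A \<inter> ?K)" by simp
    have "(A \<inter> ?K) \<union> ?r ` (A \<inter> ?K) \<subseteq> ?K" by auto
    then have "card ((A \<inter> ?K) \<union> ?r ` (A \<inter> ?K)) \<le> card ?K" by (intro card_mono) auto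
    moreover have "card ((A \<inter> ?K) \<union> ?r ` (A \<inter> ?K)) = card (A \<inter> ?K) + card (?r ` (A \<inter> ?K))"
      using no by (intro card_Un_disjoint) auto
    moreover have "card (?r ` (A \<inter> ?K)) = card (A \<inter> ?K)" by (intro card_image) (auto simp: inj_on_def)
    ultimately have "2 * card (A \<inter> ?K) \<le> nat (l - 1 - (int m + 2) + 1)" by simp
    then show False using cA many six by linarith
  qed
  then obtain c where c: "c \<in> A" "?r c \<in> A" by blast
  have "cosum l ({#c, ?r c#} + replicate_mset (m - 1) 0) = int m * l - (int m + 1)"
    using m1 by (simp add: cosum_def of_nat_diff algebra_simps)
  moreover have "set_mset ({#c, ?r c#} + replicate_mset (m - 1) 0) \<subseteq> A"
    using c zero_in by (auto split: if_splits)
  ultimately show "\<exists>Y. set_mset Y \<subseteq> A \<and> cosum l Y = int m * l - (int m + 1)" by blast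
qed

end

section \<open>Translation of the bounds on \<open>m\<close>, and the reflected extremal
  case\<close>

theorem theorem4:
  fixes A E E' :: "int set" and l :: int and n m :: nat
  assumes "finite A"
    and "n = card A" and "n \<ge> 6"
    and "Min A = 0" and "Gcd A = 1"
    and "l = Max A"
    and "E = exceptional_set A"
    and "E' = exceptional_set ((\<lambda>a. l - a) ` A)"
    and "real m \<ge> max (real_of_int l - 3/2 * real n + 9/2) (2/3 * (real_of_int l - real n + 2))"
  shows "(\<not> ({0, 1} \<subseteq> A \<and> A \<subseteq> {0, 1} \<union> {int m + 2..l}) \<and>
          \<not> ({l - 1, l} \<subseteq> A \<and> A \<subseteq> {0..l - (int m + 2)} \<union> {l - 1, l})
            \<longrightarrow> mfold_sumset m A = {0..int m * l} - (E \<union> (\<lambda>e. int m * l - e) ` E')) \<and>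
         (({0, 1} \<subseteq> A \<and> A \<subseteq> {0, 1} \<union> {int m + 2..l}) \<or>
          ({l - 1, l} \<subseteq> A \<and> A \<subseteq> {0..l - (int m + 2)} \<union> {l - 1, l})
            \<longrightarrow> mfold_sumset m A \<noteq> {0..int m * l} - (E \<union> (\<lambda>e. int m * l - e) ` E'))"
proof -
  let ?B = "(\<lambda>a. l - a) ` A"
  let ?T = "{0..int m * l} - (E \<union> (\<lambda>e. int m * l - e) ` E')"
  let ?low = "{0, 1} \<subseteq> A \<and> A \<subseteq> {0, 1} \<union> {int m + 2..l}"
  let ?high = "{l - 1, l} \<subseteq> A \<and> A \<subseteq> {0..l - (int m + 2)} \<union> {l - 1, l}"
  have ne: "A \<noteq> {}" using assms(2,3) by auto
  have zero: "0 \<in> A" and lA: "l \<in> A" and sub: "A \<subseteq> {0..l}"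
    using Min_in[OF assms(1) ne] Max_in[OF assms(1) ne] Min_le[OF assms(1)] Max_ge[OF assms(1)]
    unfolding assms(4) assms(6) by auto
  have "card A \<le> card {0..l}" using sub by (intro card_mono) auto
  then have n_le: "int n \<le> l + 1" using assms(2,3) by simp
  interpret sumset_ends A l
    by unfold_locales (use zero lA sub n_le assms(3) in auto)
  have "A = insert 0 (insert l (A \<inter> {0<..<l}))" using sub zero lA by force
  then have "card A = Suc (Suc (card (A \<inter> {0<..<l})))"
    using assms(1) l_pos by (metis (no_types, lifting) card_insert_disjoint finite_Int finite_insert
        greaterThanLessThan_iff insert_iff IntD2 less_irrefl)
  moreover have "card (A \<inter> {0<..<l}) + card (holes A l) = nat (l - 1)"
    using card_Int_Diff[of "{0<..<l}" A] by (simp add: holes_def Int_commute)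
  ultimately have ch: "int (card (holes A l)) = l - int n + 1" using assms(2) l_pos by linarith
  have real_m: "real m \<ge> real_of_int l - 3/2 * real n + 9/2" "real m \<ge> 2/3 * (real_of_int l - real n + 2)"
    using assms(9) by auto
  have "real_of_int (2 * int m) \<ge> real_of_int (2 * l - 3 * int n + 9)" using real_m(1) by simp
  then have h1: "2 * int m \<ge> 2 * l - 3 * int n + 9" by linarith
  have "real_of_int (3 * int m) \<ge> real_of_int (2 * l - 2 * int n + 4)" using real_m(2) by simp
  then have h2: "3 * int m \<ge> 2 * l - 2 * int n + 4" by linarith
  have "3 * int m > 0" using h2 n_le by linarith
  then have m1: "m \<ge> 1" by simp
  \<comment> \<open>With \<open>l - n + 1\<close> holes, the first lower bound on \<open>m\<close>
    yields \<open>many\<close> and \<open>many'\<close>, and the second is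
    \<open>few\<close>.\<close>
  have many: "card (holes A l) + 4 < m + card A" using h1 ch assms(2,3) by linarith
  have few: "2 * card (holes A l) + 2 \<le> 3 * m" using h2 ch by linarith
  have many': "l + 4 < 2 * int (card A) + int m" using h1 assms(2,3) by linarith
  have T: "u \<in> ?T \<longleftrightarrow> 0 \<le> u \<and> u \<le> int m * l \<and> (\<exists>X. set_mset X \<subseteq> A \<and> sum_mset X = u) \<and>
      (\<exists>Y. set_mset Y \<subseteq> A \<and> cosum l Y = int m * l - u)" for u
    using representable_iff[OF assms(1), of u m] assms(7,8) by auto
  have T': "u \<in> ?T" if "\<exists>X. set_mset X \<subseteq> A \<and> sum_mset X = u"
      "\<exists>Y. set_mset Y \<subseteq> A \<and> cosum l Y = int m * l - u" for u
  proof -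
    have "0 \<le> u" "0 \<le> int m * l - u" using that sum_mset_nonneg cosum_nonneg by metis+
    then have "0 \<le> u" "u \<le> int m * l" by simp_all
    then show ?thesis using T[of u] that by blast
  qed
  have "mfold_sumset m A = ?T" if "\<not> ?low" "\<not> ?high"
  proof (intro set_eqI iffI)
    fix u assume "u \<in> mfold_sumset m A"
    then obtain X where "set_mset X \<subseteq> A" "size X = m" "sum_mset X = u" by (rule mfold_sumsetE)
    then show "u \<in> ?T" by (intro T') (auto simp: cosum_def)
  next
    fix u assume "u \<in> ?T"
    then obtain X Y where "set_mset X \<subseteq> A" "sum_mset X = u" "set_mset Y \<subseteq> A" "cosum l Y = int m * l - u"
      using T by blast
    then show "u \<in> mfold_sumset m A"
      using nonrepresented_imp_extremal[OF assms(1) _ _ _ _ _ many few] that by blast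
  qed
  moreover have "mfold_sumset m A \<noteq> ?T" if ?low
    using extremal_imp_nonrepresented[OF assms(1) _ m1 many'] T' that assms(2,3) by blast
  moreover have "mfold_sumset m A \<noteq> ?T" if ?high
  proof -
    interpret B: sumset_ends ?B l by (rule reflect)
    have cB: "card ?B = card A" by (intro card_image) (auto simp: inj_on_def)
    have B1: "{0, 1} \<subseteq> ?B" using that by force
    have B2: "?B \<subseteq> {0, 1} \<union> {int m + 2..l}"
    proof
      fix b assume "b \<in> ?B"
      then obtain a where "a \<in> A" "b = l - a" by blast
      then have "a \<in> {0..l - (int m + 2)} \<union> {l - 1, l}" using that by blast
      then show "b \<in> {0, 1} \<union> {int m + 2..l}" using \<open>b = l - a\<close> by auto
    qed
    note B = B.extremal_imp_nonrepresented[OF finite_imageI[OF assms(1)] _ m1 _ B1 B2]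
    \<comment> \<open>The mirror image of \<open>m + 1\<close>, the number missed by the
      \<open>m\<close>-fold sumset of \<open>?B\<close>.\<close>
    let ?u = "int m * l - (int m + 1)"
    have "?u \<notin> mfold_sumset m A"
    proof
      assume "?u \<in> mfold_sumset m A"
      then obtain X where X: "set_mset X \<subseteq> A" "size X = m" "sum_mset X = ?u" by (rule mfold_sumsetE)
      then have "int m + 1 \<in> mfold_sumset m ?B"
        by (intro mfold_sumsetI[of "image_mset (\<lambda>a. l - a) X"]) (auto simp: sum_mset_reflect cosum_def)
      then show False using B(1) cB assms(2,3) many' by simp
    qed
    moreover have "\<exists>Y. set_mset Y \<subseteq> A \<and> cosum l Y = int m * l - ?u"
      using B(2) reflect_mset_ex[where A = A and l = l and P = "\<lambda>X. sum_mset X = int m + 1"] cB assms(2,3) many'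
      by (simp add: sum_mset_reflect)
    moreover have "\<exists>X. set_mset X \<subseteq> A \<and> sum_mset X = ?u"
      using B(3) reflect_mset_ex[where A = A and l = l and P = "\<lambda>X. cosum l X = ?u"] cB assms(2,3) many'
      by (simp add: cosum_reflect)
    ultimately show ?thesis using T' by blast
  qed
  ultimately show ?thesis by blast
qed

end
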